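(* Let $T>0$ and let $\{\theta_n\}_{n\in\mathbb{N}}$ be the Kac-Stroock kernels in dimension $d=1$, that is, $\theta_n(t)=n^{\frac12}(-1)^{N_n(t)}$, $t\in[0,T]$, where $N_n$ is a (one-parameter) Poisson process with intensity $n$. Then for any even integer $m\in\mathbb{N}$ there is a positive constant $C$ independent of $n$ such that, for any sequence of functions $\{g_n\}_{n\in\mathbb{N}}\subset L^2([0,T])$ and every $n\in\mathbb{N}$, $$\mathbb{E}\left[\left|\int_{0}^{T}g_n(u)\theta_n(u)\,du\right|^m\right]\le C\left(\int_0^T|g_n(u)|^2\,du\right)^{\frac m2}.$$
   Context: A Poisson process with intensity $\mu>0$ is a càdlàg process $N_\mu$ on $[0,T]$ with $N_\mu(0)=0$ such that, for $0\le s<t$, $N_\mu(t)-N_\mu(s)$ is independent of $\sigma(N_\mu(r):r\le s)$ (completed) and has a Poisson law of parameter $\mu(t-s)$. *)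

theory Defs
  imports "HOL-Probability.Probability"
begin

definition cadlag_on :: "real \<Rightarrow> (real \<Rightarrow> 'b::topological_space) \<Rightarrow> bool" where
  "cadlag_on T f \<longleftrightarrow>
     (\<forall>t\<in>{0..<T}. (f \<longlongrightarrow> f t) (at_right t)) \<and>
     (\<forall>t\<in>{0<..T}. \<exists>l. (f \<longlongrightarrow> l) (at_left t))"

text \<open>
  The sigma-algebra generated by the variables \<open>N r\<close>, \<open>0 \<le> r \<le> s\<close>, augmented by the
  null sets of the completed measure. Since \<open>M\<close> itself need not be complete, this is a
  sub-sigma-algebra of \<open>completion M\<close>, in general not of \<open>M\<close>.
\<close>
definition completed_history ::
    "'a measure \<Rightarrow> (real \<Rightarrow> 'a \<Rightarrow> nat) \<Rightarrow> real \<Rightarrow> 'a set set" where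
  "completed_history M N s =
     sigma_sets (space M)
       ((\<Union>r\<in>{0..s}. sets (vimage_algebra (space M) (N r) (count_space UNIV)))
         \<union> null_sets (completion M))"

text \<open>
  Increments are taken in \<^typ>\<open>int\<close>, because subtraction on \<^typ>\<open>nat\<close> truncates;
  monotonicity of the paths is not assumed.
\<close>
definition increment :: "(real \<Rightarrow> 'a \<Rightarrow> nat) \<Rightarrow> real \<Rightarrow> real \<Rightarrow> 'a \<Rightarrow> int" where
  "increment N s t \<omega> = int (N t \<omega>) - int (N s \<omega>)"

definition poisson_process ::
    "'a measure \<Rightarrow> real \<Rightarrow> real \<Rightarrow> (real \<Rightarrow> 'a \<Rightarrow> nat) \<Rightarrow> bool" where
  "poisson_process M T \<mu> N \<longleftrightarrow>
     \<mu> > 0 \<and>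
     (\<forall>t\<in>{0..T}. N t \<in> measurable M (count_space UNIV)) \<and>
     (\<forall>\<omega>\<in>space M. cadlag_on T (\<lambda>t. real (N t \<omega>))) \<and>
     (\<forall>\<omega>\<in>space M. N 0 \<omega> = 0) \<and>
     (\<forall>s t. 0 \<le> s \<and> s < t \<and> t \<le> T \<longrightarrow>
        prob_space.indep_set (completion M)
          (sets (vimage_algebra (space M) (increment N s t) (count_space UNIV)))
          (completed_history M N s) \<and>
        distr M (count_space UNIV) (increment N s t)
          = measure_pmf (map_pmf int (poisson_pmf (\<mu> * (t - s)))))"

definition kac_stroock ::
    "nat \<Rightarrow> (real \<Rightarrow> 'a \<Rightarrow> nat) \<Rightarrow> real \<Rightarrow> 'a \<Rightarrow> real" where
  "kac_stroock n N t \<omega> = sqrt (real n) * (- 1) ^ N t \<omega>"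

definition L2_on :: "real \<Rightarrow> (real \<Rightarrow> real) set" where
  "L2_on T = {f \<in> borel_measurable (lebesgue_on {0..T}).
                integrable (lebesgue_on {0..T}) (\<lambda>u. \<bar>f u\<bar>\<^sup>2)}"

end

theory Submission
  imports Defs
begin

text \<open>
  Write \<open>S u = (-1) ^ N u\<close> and \<open>X t = \<integral>\<^sub>0\<^sup>t g u S u du\<close>. Applying
  \<open>X t ^ (k + 1) = (k + 1) \<integral>\<^sub>0\<^sup>t g s S s X s ^ k ds\<close> twice and taking expectations produces
  \<open>E[S r S s X r ^ k]\<close> for \<open>r \<le> s\<close>. Since \<open>X r\<close> is determined by the history up to \<open>r\<close>,
  independence of the increment over \<open>[r, s]\<close> factors this as \<open>exp (-2\<mu>(s - r)) E[X r ^ k]\<close>.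
  By \<open>2 |g r g s| \<le> g r ^ 2 + g s ^ 2\<close>, and since the exponential kernel has mass at most
  \<open>1 / (2\<mu>)\<close> in either variable, each such double step costs a factor
  \<open>(k + 2) (k + 1) \<parallel>g\<parallel>^2 / (2\<mu>)\<close>; the factor \<open>1 / \<mu>\<close> cancels against the square of the
  amplitude \<open>\<surd>n\<close> of the Kac-Stroock kernel.
\<close>

section \<open>Products of integrals and powers of primitives for diffuse measures\<close>

lemma (in pair_sigma_finite) integrable_mult_pair:
  fixes f g :: "_ \<Rightarrow> real"
  assumes f: "integrable M1 f" and g: "integrable M2 g"
  shows "integrable (M1 \<Otimes>\<^sub>M M2) (\<lambda>(x, y). f x * g y)"
proof (rule Fubini_integrable)
  have [measurable]: "f \<in> borel_measurable M1" "g \<in> borel_measurable M2"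
    using f g by auto
  show "(\<lambda>(x, y). f x * g y) \<in> borel_measurable (M1 \<Otimes>\<^sub>M M2)" by measurable
qed (use f g in \<open>auto simp: abs_mult\<close>)

text \<open>Integration by parts for primitives, obtained from Fubini alone: the product is a double
  integral over the square, which is split along the diagonal. No differentiability of the
  primitives enters, so merely integrable \<open>f\<close> and \<open>g\<close> are allowed.\<close>

lemma diffuse_integral_mult:
  fixes L :: "real measure" and f g :: "real \<Rightarrow> real"
  assumes L: "sigma_finite_measure L" and id: "(\<lambda>x. x) \<in> borel_measurable L"
    and diffuse: "\<And>x. x \<in> space L \<Longrightarrow> {x} \<in> null_sets L"
    and f: "integrable L f" and g: "integrable L g"
  shows "(\<integral>x. f x \<partial>L) * (\<integral>y. g y \<partial>L) =
    (\<integral>x. f x * (\<integral>y. (if y \<le> x then g y else 0) \<partial>L) \<partial>L) +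
    (\<integral>y. g y * (\<integral>x. (if x \<le> y then f x else 0) \<partial>L) \<partial>L)"
proof -
  interpret L: sigma_finite_measure L by fact
  interpret P: pair_sigma_finite L L ..
  note [measurable] = id
  have [measurable]: "f \<in> borel_measurable L" "g \<in> borel_measurable L"
    using f g by auto
  have [measurable]: "(\<lambda>p. fst p) \<in> borel_measurable (L \<Otimes>\<^sub>M L)"
      "(\<lambda>p. snd p) \<in> borel_measurable (L \<Otimes>\<^sub>M L)"
    using measurable_compose[OF measurable_fst id] measurable_compose[OF measurable_snd id] by auto
  have fg: "integrable (L \<Otimes>\<^sub>M L) (\<lambda>(x, y). f x * g y)"
    by (rule P.integrable_mult_pair[OF f g])
  have lower: "integrable (L \<Otimes>\<^sub>M L) (\<lambda>(x, y). f x * (if y \<le> x then g y else 0))"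
    by (rule Bochner_Integration.integrable_bound[OF fg]) (auto simp: split_beta abs_mult)
  have upper: "integrable (L \<Otimes>\<^sub>M L) (\<lambda>(x, y). g y * (if x < y then f x else 0))"
    by (rule Bochner_Integration.integrable_bound[OF fg]) (auto simp: split_beta abs_mult)
  \<comment> \<open>The pointwise splitting must count the diagonal once, so one half is strict.
    Diffuseness then restores the symmetric form of the two inner integrals.\<close>
  have strict: "(\<integral>x. (if x < y then f x else 0) \<partial>L) = (\<integral>x. (if x \<le> y then f x else 0) \<partial>L)"
    if "y \<in> space L" for y
    by (intro integral_cong_AE AE_I'[OF diffuse[OF that]]) auto
  have "(\<integral>x. f x \<partial>L) * (\<integral>y. g y \<partial>L) = (\<integral>x. (\<integral>y. f x * g y \<partial>L) \<partial>L)"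
    by simp
  also have "\<dots> = (\<integral>(x, y). f x * g y \<partial>(L \<Otimes>\<^sub>M L))"
    using P.integral_fst'[OF fg] by simp
  also have "\<dots> = (\<integral>p. (case p of (x, y) \<Rightarrow> f x * (if y \<le> x then g y else 0)) +
      (case p of (x, y) \<Rightarrow> g y * (if x < y then f x else 0)) \<partial>(L \<Otimes>\<^sub>M L))"
    by (rule Bochner_Integration.integral_cong) auto
  also have "\<dots> = (\<integral>(x, y). f x * (if y \<le> x then g y else 0) \<partial>(L \<Otimes>\<^sub>M L)) +
      (\<integral>(x, y). g y * (if x < y then f x else 0) \<partial>(L \<Otimes>\<^sub>M L))"
    by (rule Bochner_Integration.integral_add[OF lower upper])
  also have "\<dots> = (\<integral>x. (\<integral>y. f x * (if y \<le> x then g y else 0) \<partial>L) \<partial>L) +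
      (\<integral>y. (\<integral>x. g y * (if x < y then f x else 0) \<partial>L) \<partial>L)"
    using P.integral_fst'[OF lower] P.integral_snd[OF upper] by simp
  also have "(\<integral>y. (\<integral>x. g y * (if x < y then f x else 0) \<partial>L) \<partial>L) =
      (\<integral>y. g y * (\<integral>x. (if x \<le> y then f x else 0) \<partial>L) \<partial>L)"
    by (intro Bochner_Integration.integral_cong) (simp_all add: strict)
  finally show ?thesis by simp
qed

text \<open>The chain rule for powers of a primitive, in integrated form. The induction applies
  \<open>diffuse_integral_mult\<close> to \<open>h\<close> and \<open>h * H ^ k\<close>, both cut
  off at \<open>t\<close>; the two halves yield the same integral with weights 1 and
  \<open>k + 1\<close>, which add up to \<open>k + 2\<close>.\<close>

lemma diffuse_primitive_power:
  fixes L :: "real measure" and h :: "real \<Rightarrow> real"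
  assumes L: "sigma_finite_measure L" and id: "(\<lambda>x. x) \<in> borel_measurable L"
    and diffuse: "\<And>x. x \<in> space L \<Longrightarrow> {x} \<in> null_sets L" and h: "integrable L h"
  defines "H \<equiv> \<lambda>t. (\<integral>u. (if u \<le> t then h u else 0) \<partial>L)"
  shows "H t ^ Suc k = real (Suc k) * (\<integral>s. (if s \<le> t then h s * H s ^ k else 0) \<partial>L)"
proof (induction k arbitrary: t)
  case 0
  show ?case by (simp add: H_def cong: if_cong)
next
  case (Suc k)
  interpret L: sigma_finite_measure L by fact
  note [measurable] = id
  have [measurable]: "h \<in> borel_measurable L" using h by auto
  have [measurable]: "(\<lambda>p. fst p) \<in> borel_measurable (L \<Otimes>\<^sub>M L)"
      "(\<lambda>p. snd p) \<in> borel_measurable (L \<Otimes>\<^sub>M L)"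
    using measurable_compose[OF measurable_fst id] measurable_compose[OF measurable_snd id] by auto
  have [measurable]: "H \<in> borel_measurable L" unfolding H_def by measurable
  define f where "f u = (if u \<le> t then h u else 0)" for u
  define g where "g u = (if u \<le> t then h u * H u ^ k else 0)" for u
  \<comment> \<open>A primitive is bounded by the L1 norm of its density, so \<open>h\<close> times
    any power of \<open>H\<close> stays integrable.\<close>
  have H_bound: "\<bar>H s\<bar> \<le> (\<integral>u. \<bar>h u\<bar> \<partial>L)" for s
  proof -
    have "\<bar>H s\<bar> \<le> (\<integral>u. \<bar>if u \<le> s then h u else 0\<bar> \<partial>L)"
      unfolding H_def by (rule integral_abs_bound)
    also have "\<dots> \<le> (\<integral>u. \<bar>h u\<bar> \<partial>L)"
      by (rule integral_mono_AE') (use h in auto)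
    finally show ?thesis .
  qed
  have int_hH: "integrable L (\<lambda>u. h u * H u ^ j)" for j
  proof (rule Bochner_Integration.integrable_bound)
    show "integrable L (\<lambda>u. h u * (\<integral>u. \<bar>h u\<bar> \<partial>L) ^ j)" using h by simp
    show "AE u in L. norm (h u * H u ^ j) \<le> norm (h u * (\<integral>u. \<bar>h u\<bar> \<partial>L) ^ j)"
      by (auto simp: abs_mult power_abs intro!: mult_left_mono power_mono order_trans[OF H_bound])
  qed measurable
  have f: "integrable L f"
    by (rule Bochner_Integration.integrable_bound[OF h]) (auto simp: f_def[abs_def])
  have g: "integrable L g"
    by (rule Bochner_Integration.integrable_bound[OF int_hH[of k]]) (auto simp: g_def[abs_def])
  have int_f: "(\<integral>u. (if u \<le> s then f u else 0) \<partial>L) = H s" if "s \<le> t" for s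
    unfolding H_def f_def using that by (intro Bochner_Integration.integral_cong) auto
  have int_g: "real (Suc k) * (\<integral>u. (if u \<le> s then g u else 0) \<partial>L) = H s ^ Suc k" if "s \<le> t" for s
    unfolding Suc.IH g_def using that
    by (intro arg_cong2[where f="(*)"] Bochner_Integration.integral_cong) auto
  have mult: "(\<integral>u. f u \<partial>L) * (\<integral>u. g u \<partial>L) =
      (\<integral>s. f s * (\<integral>u. (if u \<le> s then g u else 0) \<partial>L) \<partial>L) +
      (\<integral>s. g s * (\<integral>u. (if u \<le> s then f u else 0) \<partial>L) \<partial>L)"
    using L id diffuse f g by (rule diffuse_integral_mult)
  have "H t ^ Suc (Suc k) = real (Suc k) * ((\<integral>u. f u \<partial>L) * (\<integral>u. g u \<partial>L))"
    using Suc.IH[of t] by (simp add: f_def g_def H_def)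
  \<comment> \<open>In the first half the factor \<open>Suc k\<close> moves inside, where the
    induction hypothesis turns it and the inner integral into \<open>H s ^ Suc k\<close>; in the
    second half it stays outside.\<close>
  also have "\<dots> = (\<integral>s. f s * (real (Suc k) * (\<integral>u. (if u \<le> s then g u else 0) \<partial>L)) \<partial>L) +
      real (Suc k) * (\<integral>s. g s * (\<integral>u. (if u \<le> s then f u else 0) \<partial>L) \<partial>L)"
    by (simp only: mult distrib_left
      mult.left_commute[of "f _" "real (Suc k)"] integral_mult_right_zero)
  also have "(\<integral>s. f s * (real (Suc k) * (\<integral>u. (if u \<le> s then g u else 0) \<partial>L)) \<partial>L) =
      (\<integral>s. (if s \<le> t then h s * H s ^ Suc k else 0) \<partial>L)"
    by (intro Bochner_Integration.integral_cong refl) (unfold f_def, use int_g in auto)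
  also have "(\<integral>s. g s * (\<integral>u. (if u \<le> s then f u else 0) \<partial>L) \<partial>L) =
      (\<integral>s. (if s \<le> t then h s * H s ^ Suc k else 0) \<partial>L)"
    by (intro Bochner_Integration.integral_cong refl) (unfold g_def, use int_f in auto)
  finally show ?case by (simp add: algebra_simps)
qed

section \<open>The Poisson law and right-continuous processes\<close>

text \<open>The Poisson generating function at -1. One factor \<open>exp (- \<rho>)\<close> is the
  normalisation of the law, the other is the alternating exponential series.\<close>

lemma integral_poisson_sign:
  assumes "0 < \<rho>"
  shows "(\<integral>k. (- 1) ^ k \<partial>measure_pmf (poisson_pmf \<rho>)) = exp (- 2 * \<rho> :: real)"
proof -
  have eq: "pmf (poisson_pmf \<rho>) k * (- 1) ^ k = exp (- \<rho>) * ((- \<rho>) ^ k /\<^sub>R fact k)" for k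
  proof -
    have "(- \<rho>) ^ k = \<rho> ^ k * (- 1) ^ k"
      by (metis mult.commute mult_minus1 power_mult_distrib)
    then show ?thesis using assms by (simp add: divide_inverse)
  qed
  have "summable (\<lambda>k. norm (pmf (poisson_pmf \<rho>) k * (- 1) ^ k))"
    unfolding eq using summable_norm_exp[of "- \<rho>"]
    by (auto simp: abs_mult intro!: summable_mult)
  then have int: "integrable (count_space UNIV) (\<lambda>k. pmf (poisson_pmf \<rho>) k * (- 1) ^ k)"
    by (simp add: integrable_count_space_nat_iff)
  have "(\<integral>k. (- 1) ^ k \<partial>measure_pmf (poisson_pmf \<rho>)) =
      (\<integral>k. pmf (poisson_pmf \<rho>) k * (- 1) ^ k \<partial>count_space UNIV)"
    unfolding measure_pmf_eq_density by (subst integral_density) auto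
  also have "\<dots> = (\<Sum>k. exp (- \<rho>) * ((- \<rho>) ^ k /\<^sub>R fact k))"
    using integral_count_space_nat[OF int] by (simp only: eq)
  also have "\<dots> = exp (- \<rho>) * exp (- \<rho>)"
    using suminf_mult[OF summable_exp_generic[of "- \<rho>"]] by (simp add: exp_def)
  finally show ?thesis by (simp flip: exp_add)
qed

text \<open>Progressive measurability by sampling: \<open>u\<close> is replaced by a nearby grid
  point to its right, which takes countably many values, and right continuity recovers the process
  in the limit. Only times in \<open>[0, s]\<close> are sampled, so \<open>F\<close> may be the
  history up to \<open>s\<close>.\<close>

lemma borel_measurable_right_continuous_process:
  fixes B :: "real \<Rightarrow> 'a \<Rightarrow> real"
  assumes B: "\<And>r. r \<in> {0..s} \<Longrightarrow> B r \<in> borel_measurable F"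
    and right: "\<And>u \<omega>. u \<in> {0..<s} \<Longrightarrow> \<omega> \<in> space F \<Longrightarrow>
      ((\<lambda>r. B r \<omega>) \<longlongrightarrow> B u \<omega>) (at_right u)"
  shows "(\<lambda>(\<omega>, u). if u \<in> {0..s} then B u \<omega> else 0) \<in> borel_measurable (F \<Otimes>\<^sub>M borel)"
proof (cases "0 \<le> s")
  case True
  \<comment> \<open>With \<open>i\<close> the floor of \<open>Suc k * u\<close>, the
    \<open>+ 1\<close> gives a point strictly right of \<open>u\<close>, as a limit along
    \<open>at_right u\<close> demands. Clipping prevents sampling beyond \<open>s\<close> and keeps
    strictness for \<open>0 \<le> u < s\<close>.\<close>
  define q where "q k i = max 0 (min s ((of_int i + 1) / real (Suc k)))" for k :: nat and i :: int
  define A where "A k p = (if snd p \<in> {0..s} then B (q k \<lfloor>real (Suc k) * snd p\<rfloor>) (fst p) else 0)"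
    for k and p :: "'a \<times> real"
  show ?thesis
  proof (rule borel_measurable_LIMSEQ_real)
    fix k
    have q: "q k i \<in> {0..s}" for i using True by (auto simp: q_def)
    have [measurable]: "(\<lambda>p. B (q k i) (fst p)) \<in> borel_measurable (F \<Otimes>\<^sub>M borel)" for i
      by (rule measurable_compose[OF measurable_fst B[OF q]])
    have [measurable]:
      "(\<lambda>p. B (q k \<lfloor>real (Suc k) * snd p\<rfloor>) (fst p)) \<in> borel_measurable (F \<Otimes>\<^sub>M borel)"
      by (rule measurable_compose_countable[where f="\<lambda>i p. B (q k i) (fst p)"]) measurable
    show "A k \<in> borel_measurable (F \<Otimes>\<^sub>M borel)"
      unfolding A_def[abs_def] by measurable
  next
    fix p assume "p \<in> space (F \<Otimes>\<^sub>M (borel :: real measure))"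
    then obtain \<omega> u where p: "p = (\<omega>, u)" and \<omega>: "\<omega> \<in> space F"
      by (auto simp: space_pair_measure)
    consider "u \<notin> {0..s}" | "u = s" | "u \<in> {0..<s}" by force
    then have "(\<lambda>k. A k p) \<longlonglongrightarrow> (if u \<in> {0..s} then B u \<omega> else 0)"
    proof cases
      case 1
      then show ?thesis by (auto simp: A_def p)
    next
      case 2
      \<comment> \<open>At the right endpoint the clipping makes the approximation exact, so no
        right limit at \<open>s\<close> is required.\<close>
      have "q k \<lfloor>real (Suc k) * s\<rfloor> = s" for k
      proof -
        have "s * real (Suc k) \<le> of_int \<lfloor>real (Suc k) * s\<rfloor> + 1"
          by (subst mult.commute) (rule real_of_int_floor_add_one_ge)
        then have "s \<le> (of_int \<lfloor>real (Suc k) * s\<rfloor> + 1) / real (Suc k)"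
          by (subst pos_le_divide_eq) simp_all
        then show ?thesis unfolding q_def using True by linarith
      qed
      then show ?thesis using 2 by (simp add: A_def p)
    next
      case 3
      have gt: "u < q k \<lfloor>real (Suc k) * u\<rfloor>" for k
      proof -
        have "u * real (Suc k) < of_int \<lfloor>real (Suc k) * u\<rfloor> + 1"
          by (subst mult.commute) (rule floor_correct[THEN conjunct2, unfolded of_int_add of_int_1])
        then have "u < (of_int \<lfloor>real (Suc k) * u\<rfloor> + 1) / real (Suc k)"
          by (subst pos_less_divide_eq) simp_all
        then show ?thesis unfolding q_def using 3 by auto
      qed
      have le: "q k \<lfloor>real (Suc k) * u\<rfloor> \<le> u + 1 / real (Suc k)" for k
      proof -
        have "of_int \<lfloor>real (Suc k) * u\<rfloor> + 1 \<le> real (Suc k) * u + 1"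
          by (intro add_right_mono of_int_floor_le)
        then have "(of_int \<lfloor>real (Suc k) * u\<rfloor> + 1) / real (Suc k) \<le> (real (Suc k) * u + 1) / real (Suc k)"
          by (intro divide_right_mono) auto
        also have "\<dots> = u + 1 / real (Suc k)" by (simp add: add_divide_distrib del: of_nat_Suc)
        finally have "(of_int \<lfloor>real (Suc k) * u\<rfloor> + 1) / real (Suc k) \<le> u + 1 / real (Suc k)" .
        moreover have "0 \<le> u + 1 / real (Suc k)" using 3 by simp
        ultimately show ?thesis unfolding q_def by linarith
      qed
      have "(\<lambda>k. u + 1 / real (Suc k)) \<longlonglongrightarrow> u + 0"
        by (intro tendsto_add tendsto_const LIMSEQ_Suc[OF lim_1_over_n])
      then have upper: "(\<lambda>k. u + 1 / real (Suc k)) \<longlonglongrightarrow> u" by simp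
      have "(\<lambda>k. q k \<lfloor>real (Suc k) * u\<rfloor>) \<longlonglongrightarrow> u"
      proof (rule tendsto_sandwich[OF _ _ tendsto_const upper])
        show "\<forall>\<^sub>F k in sequentially. u \<le> q k \<lfloor>real (Suc k) * u\<rfloor>"
          by (rule eventuallyI) (rule less_imp_le[OF gt])
        show "\<forall>\<^sub>F k in sequentially. q k \<lfloor>real (Suc k) * u\<rfloor> \<le> u + 1 / real (Suc k)"
          by (rule eventuallyI) (rule le)
      qed
      then have "filterlim (\<lambda>k. q k \<lfloor>real (Suc k) * u\<rfloor>) (at_right u) sequentially"
        using gt by (simp add: filterlim_at less_imp_neq[symmetric] del: of_nat_Suc)
      from filterlim_compose[OF right[OF 3 \<omega>] this] show ?thesis
        using 3 by (simp add: A_def p)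
    qed
    then show "(\<lambda>k. A k p) \<longlonglongrightarrow> (case p of (\<omega>, u) \<Rightarrow> if u \<in> {0..s} then B u \<omega> else 0)"
      by (simp add: p)
  qed
qed (simp add: split_beta)

section \<open>The telegraph signal and its weighted integral\<close>

text \<open>A single index of the sequence, with \<open>\<mu>\<close> standing for n. The signal
  \<open>S\<close> has unit amplitude; the factor \<open>sqrt n\<close> is restored only in the
  theorem.\<close>

locale telegraph_integral = prob_space M for M :: "'a measure" +
  fixes T \<mu> :: real and N :: "real \<Rightarrow> 'a \<Rightarrow> nat" and g :: "real \<Rightarrow> real"
  assumes T_pos: "0 < T" and poisson: "poisson_process M T \<mu> N" and g_L2: "g \<in> L2_on T"
begin

abbreviation L :: "real measure" where "L \<equiv> lebesgue_on {0..T}"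

definition S :: "real \<Rightarrow> 'a \<Rightarrow> real" where "S u \<omega> = (- 1) ^ N u \<omega>"

text \<open>The cut-off under the fixed measure \<open>L\<close> makes this meaningful for every
  real \<open>t\<close>: it vanishes for negative \<open>t\<close> and is constant from
  \<open>T\<close> on. The recursion for the moments therefore carries no range condition on
  \<open>t\<close>.\<close>

definition X :: "real \<Rightarrow> 'a \<Rightarrow> real" where
  "X t \<omega> = (\<integral>u. (if u \<le> t then g u * S u \<omega> else 0) \<partial>L)"

text \<open>The history without added null sets, packaged as a measure so that
  \<open>borel_measurable\<close> can express adaptedness. Its sets lie in
  \<open>completed_history\<close>, and independence passes to smaller families.\<close>

definition history :: "real \<Rightarrow> 'a measure" where
  "history s = sigma (space M)
     (\<Union>r\<in>{0..s}. sets (vimage_algebra (space M) (N r) (count_space UNIV)))"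

lemma space_history [simp]: "space (history s) = space M"
  by (simp add: history_def space_measure_of_conv)

lemma sets_history: "sets (history s) = sigma_sets (space M)
    (\<Union>r\<in>{0..s}. sets (vimage_algebra (space M) (N r) (count_space UNIV)))"
proof -
  have "(\<Union>r\<in>{0..s}. sets (vimage_algebra (space M) (N r) (count_space UNIV))) \<subseteq> Pow (space M)"
    by (intro UN_least order_trans[OF sets.space_closed]) simp
  then show ?thesis by (simp add: history_def)
qed

lemma mu_pos: "0 < \<mu>" using poisson by (simp add: poisson_process_def)

lemma N_measurable: "t \<in> {0..T} \<Longrightarrow> N t \<in> M \<rightarrow>\<^sub>M count_space UNIV"
  using poisson by (simp add: poisson_process_def)

lemma space_L [simp]: "space L = {0..T}" by simp

lemma id_L [measurable]: "(\<lambda>x. x) \<in> borel_measurable L"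
  by (intro measurable_restrict_space1 measurable_completion) simp

sublocale L: finite_measure L by (intro finite_measure_lebesgue_on) simp

sublocale MxL: pair_sigma_finite M L ..

sublocale LL: pair_sigma_finite L L ..

lemma singleton_null_L: "x \<in> space L \<Longrightarrow> {x} \<in> null_sets L"
  by (subst null_sets_restrict_space) auto

lemma g_measurable [measurable]: "g \<in> borel_measurable L"
  using g_L2 by (simp add: L2_on_def)

lemma integrable_g2: "integrable L (\<lambda>u. (g u)\<^sup>2)"
  using g_L2 by (simp add: L2_on_def)

lemma integrable_g: "integrable L g"
proof (rule Bochner_Integration.integrable_bound)
  show "integrable L (\<lambda>u. 1 + (g u)\<^sup>2)" using integrable_g2 by simp
  have "\<bar>x\<bar> \<le> 1 + x\<^sup>2" for x :: real
    using sum_squares_bound[of 1 "\<bar>x\<bar>"] by (simp add: power2_eq_square)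
  then show "AE u in L. norm (g u) \<le> norm (1 + (g u)\<^sup>2)" by simp
qed simp

lemma abs_S [simp]: "\<bar>S u \<omega>\<bar> = 1" by (simp add: S_def)

text \<open>Integer values that converge are eventually equal to their limit, so right continuity of
  the counting path makes the sign locally constant to the right.\<close>

lemma S_right_continuous:
  assumes "u \<in> {0..<T}" "\<omega> \<in> space M"
  shows "((\<lambda>r. S r \<omega>) \<longlongrightarrow> S u \<omega>) (at_right u)"
proof (rule tendsto_eventually)
  have "((\<lambda>r. real (N r \<omega>)) \<longlongrightarrow> real (N u \<omega>)) (at_right u)"
    using poisson assms by (auto simp: poisson_process_def cadlag_on_def)
  from tendstoD[OF this, of 1]
  have "\<forall>\<^sub>F r in at_right u. N r \<omega> = N u \<omega>"
    by (auto simp: dist_real_def elim!: eventually_mono)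
  then show "\<forall>\<^sub>F r in at_right u. S r \<omega> = S u \<omega>"
    by (auto simp: S_def elim!: eventually_mono)
qed

section \<open>Joint measurability, adaptedness and path bounds\<close>

text \<open>The sigma-algebra \<open>F\<close> is left open because two cases are needed:
  \<open>M\<close> itself, for Fubini, and \<open>history s\<close>, for adaptedness. The second
  factor is \<open>L\<close> and not \<open>borel\<close>, since \<open>g\<close> is only Lebesgue
  measurable.\<close>

lemma S_joint_measurable:
  assumes sp: "space F = space M" and s: "s \<le> T"
    and NF: "\<And>r. r \<in> {0..s} \<Longrightarrow> N r \<in> F \<rightarrow>\<^sub>M count_space UNIV"
  shows "(\<lambda>(\<omega>, u). if u \<le> s then g u * S u \<omega> else 0) \<in> borel_measurable (F \<Otimes>\<^sub>M L)"
proof -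
  have "(\<lambda>(\<omega>, u). if u \<in> {0..s} then S u \<omega> else 0) \<in> borel_measurable (F \<Otimes>\<^sub>M borel)"
  proof (rule borel_measurable_right_continuous_process)
    show "S r \<in> borel_measurable F" if "r \<in> {0..s}" for r
      unfolding S_def[abs_def] by (rule measurable_compose[OF NF[OF that]]) simp
  qed (use s S_right_continuous sp in auto)
  moreover have "(\<lambda>p. (fst p, snd p)) \<in> F \<Otimes>\<^sub>M L \<rightarrow>\<^sub>M F \<Otimes>\<^sub>M borel"
    by (intro measurable_Pair measurable_fst measurable_compose[OF measurable_snd id_L])
  ultimately have "(\<lambda>p. case (fst p, snd p) of (\<omega>, u) \<Rightarrow> if u \<in> {0..s} then S u \<omega> else 0)
      \<in> borel_measurable (F \<Otimes>\<^sub>M L)"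
    using measurable_compose by blast
  then have "(\<lambda>p. g (snd p) * (if snd p \<in> {0..s} then S (snd p) (fst p) else 0))
      \<in> borel_measurable (F \<Otimes>\<^sub>M L)"
    by (intro borel_measurable_times measurable_compose[OF measurable_snd g_measurable])
       (simp add: split_beta)
  then show ?thesis
    by (rule measurable_cong[THEN iffD1, rotated]) (auto simp: space_pair_measure)
qed

lemma gS_measurable [measurable]:
  "(\<lambda>p. g (snd p) * S (snd p) (fst p)) \<in> borel_measurable (M \<Otimes>\<^sub>M L)"
  by (rule measurable_cong[THEN iffD1, OF _ S_joint_measurable[of M T]])
     (auto simp: space_pair_measure intro: N_measurable)

lemma gS_path_measurable [measurable]:
  "\<omega> \<in> space M \<Longrightarrow> (\<lambda>u. g u * S u \<omega>) \<in> borel_measurable L"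
  using measurable_compose[OF measurable_Pair1' gS_measurable, of \<omega>] by simp

lemma integrable_gS: "\<omega> \<in> space M \<Longrightarrow> integrable L (\<lambda>u. g u * S u \<omega>)"
  by (rule Bochner_Integration.integrable_bound[OF integrable_g]) (auto simp: abs_mult)

text \<open>Adaptedness: the integrand up to \<open>s\<close> is jointly measurable over the
  history, and integrating out the time variable preserves measurability. This makes later
  increments independent of \<open>X s\<close>.\<close>

lemma X_history_measurable: "s \<le> T \<Longrightarrow> X s \<in> borel_measurable (history s)"
  unfolding X_def[abs_def]
proof (intro L.borel_measurable_lebesgue_integral S_joint_measurable)
  fix r assume r: "r \<in> {0..s}"
  show "N r \<in> history s \<rightarrow>\<^sub>M count_space UNIV"
  proof (rule measurableI)
    fix A :: "nat set"
    have "N r -` A \<inter> space M \<in> sets (vimage_algebra (space M) (N r) (count_space UNIV))"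
      by (simp add: in_vimage_algebra)
    with r have "N r -` A \<inter> space M \<in>
        (\<Union>r\<in>{0..s}. sets (vimage_algebra (space M) (N r) (count_space UNIV)))"
      by blast
    then show "N r -` A \<inter> space (history s) \<in> sets (history s)"
      unfolding sets_history space_history by (rule sigma_sets.Basic)
  qed simp
qed auto

lemma X_joint_measurable [measurable]:
  "(\<lambda>p. X (snd p) (fst p)) \<in> borel_measurable (M \<Otimes>\<^sub>M L)"
proof -
  have [measurable]: "(\<lambda>q :: ('a \<times> real) \<times> real. snd q) \<in> borel_measurable ((M \<Otimes>\<^sub>M L) \<Otimes>\<^sub>M L)"
      "(\<lambda>q :: ('a \<times> real) \<times> real. snd (fst q)) \<in> borel_measurable ((M \<Otimes>\<^sub>M L) \<Otimes>\<^sub>M L)"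
    using measurable_compose[OF measurable_snd id_L]
      measurable_compose[OF measurable_fst measurable_compose[OF measurable_snd id_L]] by auto
  have "(\<lambda>q :: ('a \<times> real) \<times> real. (fst (fst q), snd q)) \<in> (M \<Otimes>\<^sub>M L) \<Otimes>\<^sub>M L \<rightarrow>\<^sub>M M \<Otimes>\<^sub>M L"
    by measurable
  from measurable_compose[OF this gS_measurable]
  have [measurable]: "(\<lambda>q :: ('a \<times> real) \<times> real. g (snd q) * S (snd q) (fst (fst q)))
      \<in> borel_measurable ((M \<Otimes>\<^sub>M L) \<Otimes>\<^sub>M L)" by simp
  show ?thesis
    unfolding X_def by (rule L.borel_measurable_lebesgue_integral) (simp add: split_beta)
qed

lemma X_measurable [measurable]: "X s \<in> borel_measurable M"
proof -
  have [measurable]: "(\<lambda>p :: 'a \<times> real. snd p) \<in> borel_measurable (M \<Otimes>\<^sub>M L)"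
    by (rule measurable_compose[OF measurable_snd id_L])
  show ?thesis unfolding X_def[abs_def]
    by (rule L.borel_measurable_lebesgue_integral) (simp add: split_beta)
qed

text \<open>Signs have modulus 1, so the bound is deterministic. It gives moments of every order and
  the dominating function for exchanging expectation and time integral.\<close>

lemma X_bound: "\<omega> \<in> space M \<Longrightarrow> \<bar>X s \<omega>\<bar> \<le> (\<integral>u. \<bar>g u\<bar> \<partial>L)"
proof -
  assume \<omega>: "\<omega> \<in> space M"
  have "\<bar>X s \<omega>\<bar> \<le> (\<integral>u. \<bar>if u \<le> s then g u * S u \<omega> else 0\<bar> \<partial>L)"
    unfolding X_def by (rule integral_abs_bound)
  also have "\<dots> \<le> (\<integral>u. \<bar>g u\<bar> \<partial>L)"
    by (rule integral_mono_AE') (use integrable_g in \<open>auto simp: abs_mult\<close>)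
  finally show ?thesis .
qed

lemma integrable_X_power: "integrable M (\<lambda>\<omega>. X s \<omega> ^ k)"
  by (rule integrable_const_bound[where B="(\<integral>u. \<bar>g u\<bar> \<partial>L) ^ k"])
     (auto simp: power_abs intro!: power_mono X_bound)

lemma X_power_Suc:
  "\<omega> \<in> space M \<Longrightarrow> X t \<omega> ^ Suc k =
    real (Suc k) * (\<integral>s. (if s \<le> t then g s * S s \<omega> * X s \<omega> ^ k else 0) \<partial>L)"
  unfolding X_def
  by (rule diffuse_primitive_power[OF L.sigma_finite_measure_axioms id_L singleton_null_L integrable_gS])
     auto

section \<open>Independence of increments and exponential decorrelation\<close>

text \<open>Increments are integers, so the parity is read off \<open>nat\<close> of the absolute
  value; under the Poisson law they are images of naturals, and this recovers the exponent of
  \<open>integral_poisson_sign\<close>.\<close>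

lemma expectation_sign_increment:
  assumes "0 \<le> r" "r < s" "s \<le> T"
  shows "(\<lambda>\<omega>. (- 1 :: real) ^ nat \<bar>increment N r s \<omega>\<bar>) \<in> borel_measurable M"
    and "expectation (\<lambda>\<omega>. (- 1) ^ nat \<bar>increment N r s \<omega>\<bar>) = exp (- 2 * \<mu> * (s - r))"
proof -
  have [measurable]: "N r \<in> M \<rightarrow>\<^sub>M count_space UNIV" "N s \<in> M \<rightarrow>\<^sub>M count_space UNIV"
    using assms by (auto intro: N_measurable)
  have inc: "increment N r s \<in> M \<rightarrow>\<^sub>M count_space UNIV"
    unfolding increment_def by measurable
  show "(\<lambda>\<omega>. (- 1 :: real) ^ nat \<bar>increment N r s \<omega>\<bar>) \<in> borel_measurable M"
    by (rule measurable_compose[OF inc]) simp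
  have "expectation (\<lambda>\<omega>. (- 1 :: real) ^ nat \<bar>increment N r s \<omega>\<bar>) =
      (\<integral>z. (- 1) ^ nat \<bar>z\<bar> \<partial>distr M (count_space UNIV) (increment N r s))"
    by (subst integral_distr[OF inc]) simp_all
  also have "distr M (count_space UNIV) (increment N r s) =
      measure_pmf (map_pmf int (poisson_pmf (\<mu> * (s - r))))"
    using poisson assms by (simp add: poisson_process_def)
  also have "(\<integral>z. (- 1) ^ nat \<bar>z\<bar> \<partial>\<dots>) = exp (- 2 * \<mu> * (s - r))"
    using assms mu_pos by (simp add: integral_poisson_sign)
  finally show "expectation (\<lambda>\<omega>. (- 1) ^ nat \<bar>increment N r s \<omega>\<bar>) = exp (- 2 * \<mu> * (s - r))" .
qed

text \<open>Independence is given over \<open>completion M\<close>. The sigma-algebras generated by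
  the sign and by \<open>Y\<close> are contained in the two independent families and also in
  \<open>events\<close>, where completed and original probabilities agree; hence the product rule
  descends to \<open>M\<close>.\<close>

lemma indep_increment_history:
  assumes rs: "0 \<le> r" "r < s" "s \<le> T"
    and Y: "Y \<in> borel_measurable (history r)" "Y \<in> borel_measurable M"
  shows "indep_var borel (\<lambda>\<omega>. (- 1 :: real) ^ nat \<bar>increment N r s \<omega>\<bar>) borel Y"
proof -
  let ?E = "\<lambda>\<omega>. (- 1 :: real) ^ nat \<bar>increment N r s \<omega>\<bar>"
  let ?A = "sets (vimage_algebra (space M) (increment N r s) (count_space UNIV))"
  let ?B = "completed_history M N r"
  have E[measurable]: "?E \<in> borel_measurable M" by (rule expectation_sign_increment[OF rs])
  note [measurable] = Y(2)
  interpret C: prob_space "completion M" by (rule prob_space_completion)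
  have indep: "C.indep_set ?A ?B" using poisson rs by (simp add: poisson_process_def)
  have subA: "sigma_sets (space M) {?E -` A \<inter> space M | A. A \<in> sets borel} \<subseteq> ?A"
  proof -
    have "?E -` A \<inter> space M \<in> ?A" for A
    proof -
      have "?E -` A \<inter> space M = increment N r s -` {z. (- 1 :: real) ^ nat \<bar>z\<bar> \<in> A} \<inter> space M"
        by auto
      then show ?thesis by (simp only:) (rule in_vimage_algebra, simp)
    qed
    then show ?thesis
      using sets.sigma_sets_subset[of "{?E -` A \<inter> space M | A. A \<in> sets borel}"
          "vimage_algebra (space M) (increment N r s) (count_space UNIV)"] by auto
  qed
  have subB: "sigma_sets (space M) {Y -` A \<inter> space M | A. A \<in> sets borel} \<subseteq> ?B"
  proof -
    have hist: "sets (history r) \<subseteq> ?B"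
      unfolding sets_history completed_history_def by (rule sigma_sets_mono') simp
    have "{Y -` A \<inter> space M | A. A \<in> sets borel} \<subseteq> ?B"
      using measurable_sets[OF Y(1)] hist by auto
    then show ?thesis
      unfolding completed_history_def by (rule sigma_sets_mono)
  qed
  have evE: "sigma_sets (space M) {?E -` A \<inter> space M | A. A \<in> sets borel} \<subseteq> events"
    by (rule sets.sigma_sets_subset) auto
  have evY: "sigma_sets (space M) {Y -` A \<inter> space M | A. A \<in> sets borel} \<subseteq> events"
    by (rule sets.sigma_sets_subset) auto
  have "prob (a \<inter> b) = prob a * prob b"
    if a: "a \<in> sigma_sets (space M) {?E -` A \<inter> space M | A. A \<in> sets borel}"
    and b: "b \<in> sigma_sets (space M) {Y -` A \<inter> space M | A. A \<in> sets borel}" for a b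
  proof -
    have "a \<in> events" "b \<in> events" using a b evE evY by auto
    moreover have "C.prob (a \<inter> b) = C.prob a * C.prob b"
      using C.indep_setD[OF indep] a b subA subB by blast
    ultimately show ?thesis by (simp add: sets.Int)
  qed
  then show ?thesis
    unfolding indep_var_eq indep_sets2_eq using evE evY by auto
qed

text \<open>A single sign \<open>S s\<close> need not be independent of \<open>X r\<close>. In the
  product with \<open>S r\<close> the shared count \<open>N r\<close> cancels modulo 2, leaving only
  the increment over \<open>[r, s]\<close>.\<close>

lemma expectation_two_signs:
  assumes rs: "0 \<le> r" "r \<le> s" "s \<le> T"
  shows "expectation (\<lambda>\<omega>. S r \<omega> * S s \<omega> * X r \<omega> ^ k) =
    exp (- 2 * \<mu> * (s - r)) * expectation (\<lambda>\<omega>. X r \<omega> ^ k)"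
\<comment> \<open>The Poisson property speaks of \<open>r < s\<close> only. At equal times the signs
  square to 1, as does the exponential factor.\<close>
proof (cases "r = s")
  case True
  then show ?thesis by (simp add: S_def flip: power_add)
next
  case False
  then have rs': "0 \<le> r" "r < s" "s \<le> T" using rs by auto
  let ?E = "\<lambda>\<omega>. (- 1 :: real) ^ nat \<bar>increment N r s \<omega>\<bar>"
  have SS: "S r \<omega> * S s \<omega> = ?E \<omega>" for \<omega>
  proof -
    \<comment> \<open>A difference and a sum of two integers have the same parity.\<close>
    have "even (nat \<bar>increment N r s \<omega>\<bar>) \<longleftrightarrow> even (N r \<omega> + N s \<omega>)"
      by (auto simp: increment_def even_nat_iff)
    then show ?thesis unfolding S_def power_add[symmetric]
      by (simp add: minus_one_power_iff)
  qed
  note [measurable] = expectation_sign_increment(1)[OF rs']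
  have indep: "indep_var borel ?E borel (\<lambda>\<omega>. X r \<omega> ^ k)"
  proof (rule indep_increment_history[OF rs'])
    have [measurable]: "X r \<in> borel_measurable (history r)"
      using X_history_measurable[of r] rs by simp
    show "(\<lambda>\<omega>. X r \<omega> ^ k) \<in> borel_measurable (history r)" by measurable
  qed measurable
  have "integrable M ?E" by (rule integrable_const_bound[where B=1]) auto
  from indep_var_lebesgue_integral[OF indep this integrable_X_power]
  show ?thesis by (simp add: SS expectation_sign_increment(2)[OF rs'])
qed

section \<open>Recursion for the moments\<close>

text \<open>The power formula on each path, followed by Fubini with a dominating multiple of
  \<open>g\<close>. The bounded weight \<open>Z\<close> allows two uses: the constant 1 for the
  outer integral and a sign \<open>S s\<close> for the inner one.\<close>

lemma expectation_times_X_power_Suc: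
  assumes Z[measurable]: "Z \<in> borel_measurable M" and Z_le: "\<And>\<omega>. \<bar>Z \<omega>\<bar> \<le> 1"
  shows "expectation (\<lambda>\<omega>. Z \<omega> * X t \<omega> ^ Suc k) = real (Suc k) *
    (\<integral>s. (if s \<le> t then g s * expectation (\<lambda>\<omega>. Z \<omega> * S s \<omega> * X s \<omega> ^ k) else 0) \<partial>L)"
proof -
  define J where "J = (\<integral>u. \<bar>g u\<bar> \<partial>L)"
  define f where "f \<omega> s = (if s \<le> t then Z \<omega> * (g s * S s \<omega>) * X s \<omega> ^ k else 0)" for \<omega> s
  have [measurable]: "(\<lambda>p :: 'a \<times> real. snd p) \<in> borel_measurable (M \<Otimes>\<^sub>M L)"
    by (rule measurable_compose[OF measurable_snd id_L])
  have f: "integrable (M \<Otimes>\<^sub>M L) (case_prod f)"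
  proof (rule Bochner_Integration.integrable_bound)
    show "integrable (M \<Otimes>\<^sub>M L) (\<lambda>(\<omega>, s). J ^ k * g s)"
      by (rule MxL.integrable_mult_pair) (simp_all add: integrable_g)
    show "case_prod f \<in> borel_measurable (M \<Otimes>\<^sub>M L)"
      unfolding f_def split_beta by measurable
    show "AE p in M \<Otimes>\<^sub>M L. norm (case_prod f p) \<le> norm (case p of (\<omega>, s) \<Rightarrow> J ^ k * g s)"
    proof (rule AE_I2)
      fix p assume "p \<in> space (M \<Otimes>\<^sub>M L)"
      then obtain \<omega> s where p: "p = (\<omega>, s)" and \<omega>: "\<omega> \<in> space M"
        by (auto simp: space_pair_measure)
      have "\<bar>X s \<omega>\<bar> ^ k \<le> J ^ k"
        unfolding J_def by (intro power_mono X_bound \<omega>) simp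
      then have "\<bar>Z \<omega>\<bar> * \<bar>g s\<bar> * \<bar>X s \<omega>\<bar> ^ k \<le> 1 * \<bar>g s\<bar> * J ^ k"
        by (intro mult_mono Z_le) auto
      moreover have "0 \<le> J" by (simp add: J_def)
      ultimately show "norm (case_prod f p) \<le> norm (case p of (\<omega>, s) \<Rightarrow> J ^ k * g s)"
        by (auto simp: p f_def abs_mult power_abs mult_ac)
    qed
  qed
  have "expectation (\<lambda>\<omega>. Z \<omega> * X t \<omega> ^ Suc k) =
      expectation (\<lambda>\<omega>. real (Suc k) * (\<integral>s. f \<omega> s \<partial>L))"
  proof (rule Bochner_Integration.integral_cong[OF refl])
    fix \<omega> assume \<omega>: "\<omega> \<in> space M"
    have "(\<integral>s. f \<omega> s \<partial>L) =
        (\<integral>s. Z \<omega> * (if s \<le> t then g s * S s \<omega> * X s \<omega> ^ k else 0) \<partial>L)"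
      by (intro Bochner_Integration.integral_cong) (auto simp: f_def)
    then show "Z \<omega> * X t \<omega> ^ Suc k = real (Suc k) * (\<integral>s. f \<omega> s \<partial>L)"
      unfolding X_power_Suc[OF \<omega>] by simp
  qed
  also have "\<dots> = real (Suc k) * (\<integral>s. expectation (\<lambda>\<omega>. f \<omega> s) \<partial>L)"
    by (simp add: MxL.Fubini_integral[OF f])
  also have "(\<integral>s. expectation (\<lambda>\<omega>. f \<omega> s) \<partial>L) =
      (\<integral>s. (if s \<le> t then g s * expectation (\<lambda>\<omega>. Z \<omega> * S s \<omega> * X s \<omega> ^ k) else 0) \<partial>L)"
  proof (rule Bochner_Integration.integral_cong[OF refl])
    fix s
    have "f \<omega> s = g s * (if s \<le> t then Z \<omega> * S s \<omega> * X s \<omega> ^ k else 0)" for \<omega>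
      by (simp add: f_def mult_ac)
    then show "expectation (\<lambda>\<omega>. f \<omega> s) =
        (if s \<le> t then g s * expectation (\<lambda>\<omega>. Z \<omega> * S s \<omega> * X s \<omega> ^ k) else 0)"
      by simp
  qed
  finally show ?thesis .
qed

text \<open>The outer use of \<open>expectation_times_X_power_Suc\<close> releases
  \<open>S s\<close>; the inner use, with upper limit \<open>s\<close>, releases \<open>S r\<close>
  for \<open>r \<le> s\<close>. The times are thus ordered as \<open>expectation_two_signs\<close>
  requires, and the recursion closes two powers lower.\<close>

lemma moment_recursion:
  "expectation (\<lambda>\<omega>. X t \<omega> ^ Suc (Suc k)) = real (Suc (Suc k)) * real (Suc k) *
    (\<integral>s. (if s \<le> t then g s * (\<integral>r. (if r \<le> s
      then g r * (exp (- 2 * \<mu> * (s - r)) * expectation (\<lambda>\<omega>. X r \<omega> ^ k)) else 0) \<partial>L) else 0) \<partial>L)"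
proof -
  have inner: "expectation (\<lambda>\<omega>. S s \<omega> * X s \<omega> ^ Suc k) = real (Suc k) * (\<integral>r. (if r \<le> s
      then g r * (exp (- 2 * \<mu> * (s - r)) * expectation (\<lambda>\<omega>. X r \<omega> ^ k)) else 0) \<partial>L)"
    if s: "s \<in> {0..T}" for s
  proof -
    have "S s \<in> borel_measurable M"
      unfolding S_def[abs_def] by (rule measurable_compose[OF N_measurable[OF s]]) simp
    then have "expectation (\<lambda>\<omega>. S s \<omega> * X s \<omega> ^ Suc k) = real (Suc k) *
        (\<integral>r. (if r \<le> s then g r * expectation (\<lambda>\<omega>. S s \<omega> * S r \<omega> * X r \<omega> ^ k) else 0) \<partial>L)"
      by (rule expectation_times_X_power_Suc) simp
    also have "(\<integral>r. (if r \<le> s then g r * expectation (\<lambda>\<omega>. S s \<omega> * S r \<omega> * X r \<omega> ^ k) else 0) \<partial>L) =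
        (\<integral>r. (if r \<le> s
          then g r * (exp (- 2 * \<mu> * (s - r)) * expectation (\<lambda>\<omega>. X r \<omega> ^ k)) else 0) \<partial>L)"
      using s expectation_two_signs
      by (intro Bochner_Integration.integral_cong refl) (auto simp: mult.commute[of "S s _"])
    finally show ?thesis .
  qed
  have "expectation (\<lambda>\<omega>. X t \<omega> ^ Suc (Suc k)) = real (Suc (Suc k)) *
      (\<integral>s. (if s \<le> t then g s * expectation (\<lambda>\<omega>. S s \<omega> * X s \<omega> ^ Suc k) else 0) \<partial>L)"
    using expectation_times_X_power_Suc[of "\<lambda>_. 1" t "Suc k", unfolded mult_1_left] by simp
  also have "\<dots> = real (Suc (Suc k)) * (\<integral>s. real (Suc k) * (if s \<le> t then g s * (\<integral>r. (if r \<le> s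
      then g r * (exp (- 2 * \<mu> * (s - r)) * expectation (\<lambda>\<omega>. X r \<omega> ^ k)) else 0) \<partial>L) else 0) \<partial>L)"
    by (intro arg_cong2[where f="(*)"] Bochner_Integration.integral_cong refl)
       (simp only: space_L inner mult.left_commute mult_zero_right split: if_split, simp)
  finally show ?thesis by simp
qed

section \<open>The exponential kernel and its quadratic form\<close>

text \<open>The autocorrelation of the telegraph signal, restricted to the half
  \<open>r \<le> s\<close> on which the recursion integrates.\<close>

definition K :: "real \<Rightarrow> real \<Rightarrow> real" where
  "K s r = (if r \<le> s then exp (- 2 * \<mu> * (s - r)) else 0)"

lemma K_nonneg [simp]: "0 \<le> K s r" by (simp add: K_def)

lemma K_le_1: "K s r \<le> 1" using mu_pos by (simp add: K_def)

lemma K_measurable [measurable]: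
  "(\<lambda>p. K (fst p) (snd p)) \<in> borel_measurable (L \<Otimes>\<^sub>M L)"
  "K s \<in> borel_measurable L"
proof -
  have [measurable]: "(\<lambda>p. fst p) \<in> borel_measurable (L \<Otimes>\<^sub>M L)"
      "(\<lambda>p. snd p) \<in> borel_measurable (L \<Otimes>\<^sub>M L)"
    using measurable_compose[OF measurable_fst id_L] measurable_compose[OF measurable_snd id_L] by auto
  show "(\<lambda>p. K (fst p) (snd p)) \<in> borel_measurable (L \<Otimes>\<^sub>M L)"
    "K s \<in> borel_measurable L"
    unfolding K_def[abs_def] by measurable
qed

text \<open>The restriction becomes an indicator and the completion is removed, which leaves an
  \<open>lborel\<close> integral for the fundamental theorem of calculus.\<close>

lemma integral_L_FTC:
  fixes f F :: "real \<Rightarrow> real"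
  assumes "0 \<le> a" "a \<le> b" "b \<le> T"
    and "\<And>x. (F has_real_derivative f x) (at x)" and "continuous_on {a..b} f"
  shows "(\<integral>u. (if u \<in> {a..b} then f u else 0) \<partial>L) = F b - F a"
proof -
  have "(\<integral>u. (if u \<in> {a..b} then f u else 0) \<partial>L) =
      (\<integral>u. indicator {0..T} u *\<^sub>R (if u \<in> {a..b} then f u else 0) \<partial>lebesgue)"
    by (rule integral_restrict_space) simp
  also have "\<dots> = (\<integral>u. indicator {a..b} u *\<^sub>R f u \<partial>lebesgue)"
    using assms(1-3) by (intro Bochner_Integration.integral_cong) (auto simp: indicator_def)
  also have "\<dots> = (\<integral>u. indicator {a..b} u *\<^sub>R f u \<partial>lborel)"
    using borel_measurable_continuous_on_indicator[OF _ assms(5)]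
    by (intro integral_completion) simp
  also have "\<dots> = F b - F a"
    using assms(2,4,5)
    by (intro integral_FTC_atLeastAtMost)
       (auto intro: has_field_derivative_at_within simp flip: has_real_derivative_iff_has_vector_derivative)
  finally show ?thesis .
qed

lemma integral_K_right: "s \<in> {0..T} \<Longrightarrow> (\<integral>r. K s r \<partial>L) \<le> 1 / (2 * \<mu>)"
proof -
  assume s: "s \<in> {0..T}"
  have "(\<integral>r. K s r \<partial>L) = (\<integral>r. (if r \<in> {0..s} then exp (- 2 * \<mu> * (s - r)) else 0) \<partial>L)"
    by (intro Bochner_Integration.integral_cong) (auto simp: K_def)
  also have "\<dots> = exp (- 2 * \<mu> * (s - s)) / (2 * \<mu>) - exp (- 2 * \<mu> * (s - 0)) / (2 * \<mu>)"
    using s mu_pos by (intro integral_L_FTC) (auto intro!: derivative_eq_intros continuous_intros)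
  also have "\<dots> \<le> 1 / (2 * \<mu>)" using mu_pos by simp
  finally show ?thesis .
qed

lemma integral_K_left: "r \<in> {0..T} \<Longrightarrow> (\<integral>s. K s r \<partial>L) \<le> 1 / (2 * \<mu>)"
proof -
  assume r: "r \<in> {0..T}"
  have "(\<integral>s. K s r \<partial>L) = (\<integral>s. (if s \<in> {r..T} then exp (- 2 * \<mu> * (s - r)) else 0) \<partial>L)"
    by (intro Bochner_Integration.integral_cong) (auto simp: K_def)
  also have "\<dots> = - exp (- 2 * \<mu> * (T - r)) / (2 * \<mu>) - - exp (- 2 * \<mu> * (r - r)) / (2 * \<mu>)"
    using r mu_pos by (intro integral_L_FTC) (auto intro!: derivative_eq_intros continuous_intros)
  also have "\<dots> \<le> 1 / (2 * \<mu>)" using mu_pos by simp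
  finally show ?thesis .
qed

lemma integrable_mult_K:
  assumes u: "integrable L u" and v: "integrable L v"
  shows "integrable (L \<Otimes>\<^sub>M L) (\<lambda>(s, r). u s * v r * K s r)"
proof (rule Bochner_Integration.integrable_bound[OF LL.integrable_mult_pair[OF u v]])
  have [measurable]: "u \<in> borel_measurable L" "v \<in> borel_measurable L"
    using u v by auto
  show "(\<lambda>(s, r). u s * v r * K s r) \<in> borel_measurable (L \<Otimes>\<^sub>M L)"
    unfolding split_beta by measurable
  show "AE p in L \<Otimes>\<^sub>M L. norm (case p of (s, r) \<Rightarrow> u s * v r * K s r)
      \<le> norm (case p of (s, r) \<Rightarrow> u s * v r)"
    by (auto simp: abs_mult split_beta intro!: AE_I2 mult_left_le K_le_1)
qed

text \<open>Schur's test: the arithmetic-geometric mean inequality separates the two values of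
  \<open>g\<close>, and each square is integrated against the kernel in the other variable first,
  where the mass is at most \<open>1 / (2 * \<mu>)\<close>.\<close>

lemma
  shows abs_g_K_integrable: "integrable L (\<lambda>s. \<bar>g s\<bar> * (\<integral>r. \<bar>g r\<bar> * K s r \<partial>L))"
    and abs_g_K_integral_le: "(\<integral>s. \<bar>g s\<bar> * (\<integral>r. \<bar>g r\<bar> * K s r \<partial>L) \<partial>L) \<le>
       (\<integral>u. (g u)\<^sup>2 \<partial>L) / (2 * \<mu>)"
proof -
  have gg: "integrable (L \<Otimes>\<^sub>M L) (\<lambda>(s, r). \<bar>g s\<bar> * \<bar>g r\<bar> * K s r)"
    by (intro integrable_mult_K integrable_abs integrable_g)
  \<comment> \<open>The explicit 1 presents the integrand in the shape of
    \<open>integrable_mult_K\<close>; constants are integrable because \<open>L\<close> is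
    finite.\<close>
  have left: "integrable (L \<Otimes>\<^sub>M L) (\<lambda>(s, r). (g s)\<^sup>2 * 1 * K s r)"
    by (intro integrable_mult_K integrable_g2) simp
  have right: "integrable (L \<Otimes>\<^sub>M L) (\<lambda>(s, r). 1 * (g r)\<^sup>2 * K s r)"
    by (intro integrable_mult_K integrable_g2) simp
  show "integrable L (\<lambda>s. \<bar>g s\<bar> * (\<integral>r. \<bar>g r\<bar> * K s r \<partial>L))"
    using LL.integrable_fst'[OF gg] by (simp add: mult.assoc)
  have "(\<integral>s. \<bar>g s\<bar> * (\<integral>r. \<bar>g r\<bar> * K s r \<partial>L) \<partial>L) =
      (\<integral>(s, r). \<bar>g s\<bar> * \<bar>g r\<bar> * K s r \<partial>(L \<Otimes>\<^sub>M L))"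
    using LL.integral_fst'[OF gg] by (simp add: mult.assoc)
  also have "\<dots> \<le> (\<integral>p. ((case p of (s, r) \<Rightarrow> (g s)\<^sup>2 * 1 * K s r) +
      (case p of (s, r) \<Rightarrow> 1 * (g r)\<^sup>2 * K s r)) / 2 \<partial>(L \<Otimes>\<^sub>M L))"
  proof (intro integral_mono gg integrable_divide Bochner_Integration.integrable_add left right)
    fix p :: "real \<times> real"
    obtain s r where p: "p = (s, r)" by fastforce
    have "\<bar>g s\<bar> * \<bar>g r\<bar> \<le> ((g s)\<^sup>2 + (g r)\<^sup>2) / 2"
      using sum_squares_bound[of "\<bar>g s\<bar>" "\<bar>g r\<bar>"] by simp
    from mult_right_mono[OF this K_nonneg[of s r]]
    show "(case p of (s, r) \<Rightarrow> \<bar>g s\<bar> * \<bar>g r\<bar> * K s r) \<le>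
        ((case p of (s, r) \<Rightarrow> (g s)\<^sup>2 * 1 * K s r) + (case p of (s, r) \<Rightarrow> 1 * (g r)\<^sup>2 * K s r)) / 2"
      by (simp add: p algebra_simps)
  qed
  also have "\<dots> = ((\<integral>s. (g s)\<^sup>2 * (\<integral>r. K s r \<partial>L) \<partial>L) + (\<integral>r. (g r)\<^sup>2 * (\<integral>s. K s r \<partial>L) \<partial>L)) / 2"
    using LL.integral_fst'[OF left] LL.integral_snd[OF right]
      Bochner_Integration.integral_add[OF left right] by simp
  also have "\<dots> \<le> ((\<integral>s. (g s)\<^sup>2 * (1 / (2 * \<mu>)) \<partial>L) + (\<integral>r. (g r)\<^sup>2 * (1 / (2 * \<mu>)) \<partial>L)) / 2"
  proof (intro divide_right_mono add_mono integral_mono)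
    show "integrable L (\<lambda>s. (g s)\<^sup>2 * (\<integral>r. K s r \<partial>L))"
      using LL.integrable_fst'[OF left] by simp
    show "integrable L (\<lambda>r. (g r)\<^sup>2 * (\<integral>s. K s r \<partial>L))"
      using LL.integrable_snd[OF right] by simp
    show "(g s)\<^sup>2 * (\<integral>r. K s r \<partial>L) \<le> (g s)\<^sup>2 * (1 / (2 * \<mu>))" if "s \<in> space L" for s
      using that by (intro mult_left_mono integral_K_right) auto
    show "(g r)\<^sup>2 * (\<integral>s. K s r \<partial>L) \<le> (g r)\<^sup>2 * (1 / (2 * \<mu>))" if "r \<in> space L" for r
      using that by (intro mult_left_mono integral_K_left) auto
  qed (simp_all add: integrable_g2)
  also have "\<dots> = (\<integral>u. (g u)\<^sup>2 \<partial>L) / (2 * \<mu>)" by simp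
  finally show "(\<integral>s. \<bar>g s\<bar> * (\<integral>r. \<bar>g r\<bar> * K s r \<partial>L) \<partial>L) \<le> (\<integral>u. (g u)\<^sup>2 \<partial>L) / (2 * \<mu>)" .
qed

section \<open>Bounds on the even moments\<close>

text \<open>The hypothesis must hold at all times with one \<open>A\<close>, because the inner
  integral of the recursion runs over all earlier \<open>r\<close>. Absolute values then reduce the
  double integral to the quadratic form of \<open>K\<close>.\<close>

lemma moment_step:
  assumes A: "\<And>r. \<bar>expectation (\<lambda>\<omega>. X r \<omega> ^ k)\<bar> \<le> A"
  shows "\<bar>expectation (\<lambda>\<omega>. X t \<omega> ^ Suc (Suc k))\<bar> \<le>
    real (Suc (Suc k)) * real (Suc k) * (A * ((\<integral>u. (g u)\<^sup>2 \<partial>L) / (2 * \<mu>)))"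
proof -
  have A0: "0 \<le> A" using A[of 0] by linarith
  define I where "I s = (\<integral>r. (if r \<le> s
      then g r * (exp (- 2 * \<mu> * (s - r)) * expectation (\<lambda>\<omega>. X r \<omega> ^ k)) else 0) \<partial>L)" for s
  have I: "\<bar>I s\<bar> \<le> A * (\<integral>r. \<bar>g r\<bar> * K s r \<partial>L)" for s
  proof -
    have "\<bar>I s\<bar> \<le> (\<integral>r. \<bar>if r \<le> s
        then g r * (exp (- 2 * \<mu> * (s - r)) * expectation (\<lambda>\<omega>. X r \<omega> ^ k)) else 0\<bar> \<partial>L)"
      unfolding I_def by (rule integral_abs_bound)
    also have "\<dots> \<le> (\<integral>r. A * (\<bar>g r\<bar> * K s r) \<partial>L)"
    proof (rule integral_mono_AE')
      have "integrable L (\<lambda>r. \<bar>g r\<bar> * K s r)"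
        by (rule Bochner_Integration.integrable_bound[OF integrable_g])
           (auto simp: abs_mult intro!: mult_left_le K_le_1)
      then show "integrable L (\<lambda>r. A * (\<bar>g r\<bar> * K s r))" by simp
      have "\<bar>expectation (\<lambda>\<omega>. X r \<omega> ^ k)\<bar> * (\<bar>g r\<bar> * exp (- 2 * \<mu> * (s - r))) \<le>
          A * (\<bar>g r\<bar> * exp (- 2 * \<mu> * (s - r)))" for r
        by (rule mult_right_mono[OF A]) simp
      then show "AE r in L. \<bar>if r \<le> s
          then g r * (exp (- 2 * \<mu> * (s - r)) * expectation (\<lambda>\<omega>. X r \<omega> ^ k)) else 0\<bar>
          \<le> A * (\<bar>g r\<bar> * K s r)"
        by (auto simp: K_def abs_mult mult_ac)
    qed (simp add: A0)
    finally show ?thesis by simp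
  qed
  have "\<bar>\<integral>s. (if s \<le> t then g s * I s else 0) \<partial>L\<bar> \<le> (\<integral>s. \<bar>if s \<le> t then g s * I s else 0\<bar> \<partial>L)"
    by (rule integral_abs_bound)
  also have "\<dots> \<le> (\<integral>s. A * (\<bar>g s\<bar> * (\<integral>r. \<bar>g r\<bar> * K s r \<partial>L)) \<partial>L)"
  proof (rule integral_mono_AE')
    show "integrable L (\<lambda>s. A * (\<bar>g s\<bar> * (\<integral>r. \<bar>g r\<bar> * K s r \<partial>L)))"
      using abs_g_K_integrable by simp
    have "\<bar>g s\<bar> * \<bar>I s\<bar> \<le> \<bar>g s\<bar> * (A * (\<integral>r. \<bar>g r\<bar> * K s r \<partial>L))" for s
      by (rule mult_left_mono[OF I]) simp
    then show "AE s in L. \<bar>if s \<le> t then g s * I s else 0\<bar> \<le>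
        A * (\<bar>g s\<bar> * (\<integral>r. \<bar>g r\<bar> * K s r \<partial>L))"
      using A0 by (auto simp: abs_mult mult.left_commute)
  qed (simp add: A0)
  also have "\<dots> \<le> A * ((\<integral>u. (g u)\<^sup>2 \<partial>L) / (2 * \<mu>))"
    using mult_left_mono[OF abs_g_K_integral_le A0] by simp
  finally have "\<bar>\<integral>s. (if s \<le> t then g s * I s else 0) \<partial>L\<bar> \<le> A * ((\<integral>u. (g u)\<^sup>2 \<partial>L) / (2 * \<mu>))" .
  then show ?thesis
    unfolding moment_recursion I_def[symmetric] abs_mult by (intro mult_mono) auto
qed

text \<open>Each step contributes \<open>(2 * j + 2) * (2 * j + 1)\<close>, and these factors
  accumulate to the factorial.\<close>

lemma even_moment_bound:
  "\<bar>expectation (\<lambda>\<omega>. X t \<omega> ^ (2 * j))\<bar> \<le> fact (2 * j) * ((\<integral>u. (g u)\<^sup>2 \<partial>L) / (2 * \<mu>)) ^ j"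
proof (induction j arbitrary: t)
  case 0
  show ?case by (simp add: prob_space)
next
  case (Suc j)
  from moment_step[of "2 * j", OF Suc.IH, of t] show ?case
    by (simp add: mult_ac)
qed

end

section \<open>Kac-Stroock kernels of intensity n\<close>

theorem proposition3p3:
  fixes M :: "'a measure" and T :: real
    and N :: "nat \<Rightarrow> real \<Rightarrow> 'a \<Rightarrow> nat" and \<theta> :: "nat \<Rightarrow> real \<Rightarrow> 'a \<Rightarrow> real"
    and m :: nat
  assumes "prob_space M"
    and "T > 0"
    and "\<And>n. n \<ge> 1 \<Longrightarrow> poisson_process M T (real n) (N n)"
    and "\<And>n t \<omega>. n \<ge> 1 \<Longrightarrow> t \<in> {0..T} \<Longrightarrow> \<omega> \<in> space M \<Longrightarrow>
           \<theta> n t \<omega> = kac_stroock n (N n) t \<omega>"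
    and "even m"
  shows "\<exists>C>0. \<forall>g :: nat \<Rightarrow> real \<Rightarrow> real. (\<forall>n\<ge>1. g n \<in> L2_on T) \<longrightarrow>
    (\<forall>n\<ge>1.
      integrable M (\<lambda>\<omega>. \<bar>LINT u|lebesgue_on {0..T}. g n u * \<theta> n u \<omega>\<bar> ^ m) \<and>
      (LINT \<omega>|M. \<bar>LINT u|lebesgue_on {0..T}. g n u * \<theta> n u \<omega>\<bar> ^ m)
        \<le> C * (LINT u|lebesgue_on {0..T}. \<bar>g n u\<bar>\<^sup>2) ^ (m div 2))"
proof -
  obtain j where m: "m = 2 * j" using \<open>even m\<close> by blast
  show ?thesis
  \<comment> \<open>The moment bound carries \<open>(2 * n) ^ j\<close> in the denominator and the
    amplitude contributes \<open>n ^ j\<close>; what remains depends on \<open>m\<close>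
    alone.\<close>
  proof (intro exI[of _ "fact m / 2 ^ j"] conjI allI impI)
    show "0 < fact m / (2 :: real) ^ j" by simp
    fix g :: "nat \<Rightarrow> real \<Rightarrow> real" and n :: nat
    assume g: "\<forall>n\<ge>1. g n \<in> L2_on T" and n: "1 \<le> n"
    interpret P: prob_space M by fact
    interpret telegraph_integral M T "real n" "N n" "g n"
      by unfold_locales (use assms g n in auto)
    \<comment> \<open>Evenness of \<open>m\<close> removes the absolute value and turns
      \<open>sqrt n ^ m\<close> into \<open>n ^ j\<close>; the cut-off at \<open>T\<close> is always
      satisfied on \<open>L\<close>.\<close>
    have kernel: "\<bar>LINT u|L. g n u * \<theta> n u \<omega>\<bar> ^ m = real n ^ j * X T \<omega> ^ m"
      if "\<omega> \<in> space M" for \<omega>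
    proof -
      have "(LINT u|L. g n u * \<theta> n u \<omega>) =
          (LINT u|L. sqrt (real n) * (if u \<le> T then g n u * S u \<omega> else 0))"
        using assms(4)[OF n _ that]
        by (intro Bochner_Integration.integral_cong) (auto simp: kac_stroock_def S_def)
      also have "\<dots> = sqrt (real n) * X T \<omega>" by (simp add: X_def)
      finally show ?thesis
        by (simp add: m power_mult_distrib power_mult)
    qed
    have "integrable M (\<lambda>\<omega>. real n ^ j * X T \<omega> ^ m)"
      by (intro integrable_mult_right integrable_X_power)
    then show "integrable M (\<lambda>\<omega>. \<bar>LINT u|L. g n u * \<theta> n u \<omega>\<bar> ^ m)"
      by (rule Bochner_Integration.integrable_cong[THEN iffD2, rotated 2]) (simp_all add: kernel)
    have "(LINT \<omega>|M. \<bar>LINT u|L. g n u * \<theta> n u \<omega>\<bar> ^ m) = (LINT \<omega>|M. real n ^ j * X T \<omega> ^ m)"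
      by (intro Bochner_Integration.integral_cong) (simp_all add: kernel)
    also have "\<dots> = real n ^ j * P.expectation (\<lambda>\<omega>. X T \<omega> ^ m)" by simp
    also have "\<dots> \<le> real n ^ j * (fact m * ((LINT u|L. (g n u)\<^sup>2) / (2 * real n)) ^ j)"
      using even_moment_bound[of T j] by (intro mult_left_mono) (auto simp: m)
    also have "\<dots> = fact m / 2 ^ j * (LINT u|L. \<bar>g n u\<bar>\<^sup>2) ^ (m div 2)"
      using n by (simp add: m power_divide power_mult_distrib)
    finally show "(LINT \<omega>|M. \<bar>LINT u|L. g n u * \<theta> n u \<omega>\<bar> ^ m) \<le>
        fact m / 2 ^ j * (LINT u|L. \<bar>g n u\<bar>\<^sup>2) ^ (m div 2)" .
  qed
qed

end
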